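(* Let $I_1, I_2,\ldots,I_k$ be nonempty intervals in $\mathbb R$ such that $I_i\cap I_j = \emptyset$ for all $i\neq j$, let $A = \bigcup_{i=1}^kI_i$ and let $f:A\rightarrow \mathbb R$. Then $f$ is uniformly symmetrically continuous on $A$ if and only if $f$ is uniformly continuous on $A$.
   Context: Let $A$ be a nonempty subset of $\mathbb R$ and $f:A\to\mathbb R$. The function $f$ is uniformly symmetrically continuous on $A$ if for every $\varepsilon>0$ there exists $\delta>0$ such that $|f(a+h)-f(a-h)|<\varepsilon$ for all $h\in\mathbb R$ and $a\in A$ satisfying $|h|<\delta$, $a+h\in A$ and $a-h\in A$. *)

theory Defs
  imports "HOL-Analysis.Analysis"
begin

text \<open>A function \<open>A \<rightarrow> \<real>\<close> is represented by a total function on \<^typ>\<open>real\<close>; only its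
  values on \<open>A\<close> enter the definition.\<close>

definition uniformly_symmetrically_continuous_on ::
    "real set \<Rightarrow> (real \<Rightarrow> real) \<Rightarrow> bool" where
  "uniformly_symmetrically_continuous_on A f \<longleftrightarrow>
    (\<forall>\<epsilon>>0. \<exists>\<delta>>0. \<forall>h. \<forall>a\<in>A.
       \<bar>h\<bar> < \<delta> \<and> a + h \<in> A \<and> a - h \<in> A \<longrightarrow> \<bar>f (a + h) - f (a - h)\<bar> < \<epsilon>)"

end

theory Submission
  imports Defs
begin

text \<open>If \<open>A\<close> is a finite union of intervals, then for close \<open>x, y \<in> A\<close> at most one point of
  the segment from \<open>x\<close> to \<open>y\<close> lies outside \<open>A\<close>: two such points would separate two of the
  intervals by a positive distance. If the midpoint of \<open>x\<close> and \<open>y\<close> lies in \<open>A\<close>, symmetric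
  continuity compares \<open>f x\<close> with \<open>f y\<close> directly. Otherwise the midpoint is the only exceptional
  point, and the comparison goes through \<open>z = (x + 3 y) / 4\<close>, because \<open>z\<close>, the midpoint of
  \<open>x, z\<close> and the midpoint of \<open>z, y\<close> are all in \<open>A\<close>.\<close>

lemma intervals_segment_misses_at_most_one:
  fixes S T :: "real set"
  assumes S: "is_interval S" and T: "is_interval T"
  shows "\<exists>\<delta>>0. \<forall>x\<in>S. \<forall>y\<in>T. \<bar>x - y\<bar> < \<delta> \<longrightarrow>
    (\<forall>u\<in>closed_segment x y - (S \<union> T). \<forall>v\<in>closed_segment x y - (S \<union> T). u = v)"
\<comment> \<open>One bad configuration anywhere yields a gap between \<open>S\<close> and
  \<open>T\<close> that bounds all distances from below; if there is none, any positive \<delta>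
  serves.\<close>
proof (cases "\<exists>x\<in>S. \<exists>y\<in>T. \<exists>u\<in>closed_segment x y - (S \<union> T). \<exists>v\<in>closed_segment x y - (S \<union> T). u \<noteq> v")
  case True
  then obtain x y u v where xy: "x \<in> S" "y \<in> T"
    and uv: "u \<in> closed_segment x y" "v \<in> closed_segment x y" "u \<notin> S" "u \<notin> T" "v \<notin> S" "v \<notin> T"
    and "u < v"
  proof -
    obtain x y u v where "x \<in> S" "y \<in> T" "u \<in> closed_segment x y - (S \<union> T)"
      "v \<in> closed_segment x y - (S \<union> T)" "u \<noteq> v"
      using True by blast
    then show ?thesis
      by (cases u v rule: linorder_cases) (blast intro: that)+
  qed
  have IS: "c \<in> S" if "a \<in> S" "b \<in> S" "a \<le> c" "c \<le> b" for a b c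
    using S that by (metis is_interval_1)
  have IT: "c \<in> T" if "a \<in> T" "b \<in> T" "a \<le> c" "c \<le> b" for a b c
    using T that by (metis is_interval_1)
  \<comment> \<open>By convexity \<open>S\<close> stays on the side of \<open>x\<close> and
    \<open>T\<close> on the side of \<open>y\<close>: for \<open>x \<le> y\<close>, a point
    \<open>s \<ge> u\<close> of \<open>S\<close> would force \<open>u \<in> S\<close>, and a point
    \<open>t \<le> v\<close> of \<open>T\<close> would force \<open>v \<in> T\<close>.\<close>
  have far: "v - u \<le> \<bar>s - t\<bar>" if st: "s \<in> S" "t \<in> T" for s t
  proof (cases "x \<le> y")
    case True
    then have "x \<le> u" "v \<le> y"
      using uv by (auto simp: closed_segment_eq_real_ivl)
    then have "s < u" "v < t"
      using IS[of x s u] IT[of t y v] st xy uv by (meson not_less)+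
    then show ?thesis by linarith
  next
    case False
    then have "y \<le> u" "v \<le> x"
      using uv by (auto simp: closed_segment_eq_real_ivl)
    then have "t < u" "v < s"
      using IT[of y t u] IS[of s x v] st xy uv by (meson not_less)+
    then show ?thesis by linarith
  qed
  \<comment> \<open>For this \<delta> the claim is vacuous, since no point of \<open>S\<close> is
    closer than \<open>v - u\<close> to a point of \<open>T\<close>.\<close>
  show ?thesis
    using \<open>u < v\<close> far by (intro exI[of _ "v - u"]) force
next
  case False
  then show ?thesis
    by (intro exI[of _ 1]) auto
qed

text \<open>There are finitely many pairs of intervals, pairs with equal indices included, so the
  least of the pairwise bounds is still positive.\<close>

lemma Union_intervals_segment_misses_at_most_one:
  fixes I :: "'a \<Rightarrow> real set"
  assumes "finite K" and I: "\<And>i. i \<in> K \<Longrightarrow> is_interval (I i)" and A: "A = (\<Union>i\<in>K. I i)"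
  obtains \<delta> where "\<delta> > 0"
    "\<And>x y u v. \<lbrakk>x \<in> A; y \<in> A; \<bar>x - y\<bar> < \<delta>; u \<in> closed_segment x y; v \<in> closed_segment x y;
      u \<notin> A; v \<notin> A\<rbrakk> \<Longrightarrow> u = v"
proof -
  define P where "P = (\<lambda>(i, j) x y. \<forall>u\<in>closed_segment x y - (I i \<union> I j).
    \<forall>v\<in>closed_segment x y - (I i \<union> I j). u = v)"
  have "\<forall>p\<in>K \<times> K. \<exists>\<delta>>0. \<forall>x\<in>I (fst p). \<forall>y\<in>I (snd p). \<bar>x - y\<bar> < \<delta> \<longrightarrow> P p x y"
    using intervals_segment_misses_at_most_one[OF I I] by (auto simp: P_def)
  then obtain d where d: "\<And>p. p \<in> K \<times> K \<Longrightarrow> d p > 0"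
    "\<And>p x y. \<lbrakk>p \<in> K \<times> K; x \<in> I (fst p); y \<in> I (snd p); \<bar>x - y\<bar> < d p\<rbrakk> \<Longrightarrow> P p x y"
    by metis
  \<comment> \<open>The extra 1 keeps the set nonempty when \<open>K\<close> is empty.\<close>
  define \<delta> where "\<delta> = Min (insert 1 (d ` (K \<times> K)))"
  have fin: "finite (insert 1 (d ` (K \<times> K)))"
    using \<open>finite K\<close> by simp
  show thesis
  proof
    show "\<delta> > 0"
      unfolding \<delta>_def using fin d(1) by (subst Min_gr_iff) auto
    fix x y u v
    assume *: "x \<in> A" "y \<in> A" "\<bar>x - y\<bar> < \<delta>" "u \<in> closed_segment x y" "v \<in> closed_segment x y"
      "u \<notin> A" "v \<notin> A"
    then obtain i j where ij: "i \<in> K" "j \<in> K" "x \<in> I i" "y \<in> I j"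
      using A by auto
    have "\<delta> \<le> d (i, j)"
      unfolding \<delta>_def using fin ij by (intro Min_le) auto
    then have "P (i, j) x y"
      using d(2)[of "(i, j)" x y] ij * by auto
    \<comment> \<open>A point outside \<open>A\<close> lies outside both \<open>I i\<close> and
      \<open>I j\<close>, so \<open>P (i, j) x y\<close> applies.\<close>
    then show "u = v"
      using * ij A by (auto simp: P_def)
  qed
qed

lemma uniformly_continuous_imp_uniformly_symmetrically_continuous:
  assumes "uniformly_continuous_on A f"
  shows "uniformly_symmetrically_continuous_on A f"
  unfolding uniformly_symmetrically_continuous_on_def
proof (intro allI impI)
  fix \<epsilon> :: real
  assume "\<epsilon> > 0"
  then obtain \<delta> where "\<delta> > 0"
    and \<delta>: "\<And>x y. \<lbrakk>x \<in> A; y \<in> A; \<bar>y - x\<bar> < \<delta>\<rbrakk> \<Longrightarrow> \<bar>f y - f x\<bar> < \<epsilon>"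
    using assms unfolding uniformly_continuous_on_def dist_real_def by metis
  \<comment> \<open>The points \<open>a + h\<close> and \<open>a - h\<close> are
    \<open>2 * \<bar>h\<bar>\<close> apart, hence the witness \<delta> / 2.\<close>
  show "\<exists>\<delta>>0. \<forall>h. \<forall>a\<in>A. \<bar>h\<bar> < \<delta> \<and> a + h \<in> A \<and> a - h \<in> A \<longrightarrow> \<bar>f (a + h) - f (a - h)\<bar> < \<epsilon>"
    using \<open>\<delta> > 0\<close> by (intro exI[of _ "\<delta> / 2"]) (auto intro!: \<delta>)
qed

text \<open>All the geometry of \<open>A\<close> enters through \<open>miss\<close>.\<close>

lemma uniformly_symmetrically_continuous_imp_uniformly_continuous:
  fixes A :: "real set"
  assumes sym: "uniformly_symmetrically_continuous_on A f" and "\<delta> > 0"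
    and miss: "\<And>x y u v. \<lbrakk>x \<in> A; y \<in> A; \<bar>x - y\<bar> < \<delta>; u \<in> closed_segment x y;
      v \<in> closed_segment x y; u \<notin> A; v \<notin> A\<rbrakk> \<Longrightarrow> u = v"
  shows "uniformly_continuous_on A f"
  unfolding uniformly_continuous_on_def dist_real_def
proof (intro allI impI)
  fix \<epsilon> :: real
  assume "\<epsilon> > 0"
  \<comment> \<open>The detour through \<open>z\<close> adds two comparisons, each with error below
    \<epsilon> / 2.\<close>
  then have "\<epsilon> / 2 > 0" by simp
  then obtain \<eta> where "\<eta> > 0" and \<eta>: "\<And>a h. \<lbrakk>a \<in> A; \<bar>h\<bar> < \<eta>; a + h \<in> A; a - h \<in> A\<rbrakk>
      \<Longrightarrow> \<bar>f (a + h) - f (a - h)\<bar> < \<epsilon> / 2"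
    using sym unfolding uniformly_symmetrically_continuous_on_def by meson
  have mid: "\<bar>f x - f y\<bar> < \<epsilon> / 2"
    if "x \<in> A" "y \<in> A" "(x + y) / 2 \<in> A" "\<bar>x - y\<bar> < \<eta>" for x y
  proof -
    have "(x + y) / 2 + (x - y) / 2 = x" "(x + y) / 2 - (x - y) / 2 = y"
      by (simp_all add: field_simps)
    moreover have "\<bar>(x - y) / 2\<bar> < \<eta>"
      using that(4) by simp
    ultimately show ?thesis
      using \<eta>[of "(x + y) / 2" "(x - y) / 2"] that(1-3) by metis
  qed
  have "\<bar>f y - f x\<bar> < \<epsilon>" if xy: "x \<in> A" "y \<in> A" "\<bar>y - x\<bar> < min \<delta> \<eta>" for x y
  proof (cases "(x + y) / 2 \<in> A")
    case True
    then show ?thesis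
      using mid[of x y] xy by linarith
  next
    case False
    then have "x \<noteq> y"
      using xy by auto
    \<comment> \<open>The midpoint already uses up the one missing point that \<open>miss\<close>
      allows.\<close>
    have rest: "w \<in> A" if "w \<in> closed_segment x y" "w \<noteq> (x + y) / 2" for w
    proof -
      have "(x + y) / 2 \<in> closed_segment x y" "\<bar>x - y\<bar> < \<delta>"
        using xy(3) by (auto simp: closed_segment_eq_real_ivl)
      then show ?thesis
        using miss[of x y "(x + y) / 2" w] xy(1,2) that False by blast
    qed
    \<comment> \<open>The weights of \<open>y\<close> in \<open>z\<close>,
      \<open>(x + z) / 2\<close> and \<open>(z + y) / 2\<close> are 3/4, 3/8 and 7/8; none is 1/2,
      so with \<open>x \<noteq> y\<close> all three points avoid the midpoint.\<close>
    define z where "z = (x + 3 * y) / 4"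
    have "z \<in> A" "(x + z) / 2 \<in> A" "(z + y) / 2 \<in> A"
      using \<open>x \<noteq> y\<close> unfolding z_def
      by (intro rest; auto simp: closed_segment_eq_real_ivl field_simps)+
    moreover have "\<bar>x - z\<bar> < \<eta>" "\<bar>z - y\<bar> < \<eta>"
    proof -
      have "4 * z = x + 3 * y"
        by (simp add: z_def)
      then show "\<bar>x - z\<bar> < \<eta>" "\<bar>z - y\<bar> < \<eta>"
        using xy(3) by linarith+
    qed
    ultimately show ?thesis
      using mid[of x z] mid[of z y] xy(1,2) by linarith
  qed
  then show "\<exists>d>0. \<forall>x\<in>A. \<forall>x'\<in>A. \<bar>x' - x\<bar> < d \<longrightarrow> \<bar>f x' - f x\<bar> < \<epsilon>"
    using \<open>\<delta> > 0\<close> \<open>\<eta> > 0\<close> by (intro exI[of _ "min \<delta> \<eta>"]) auto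
qed

theorem theorem4p2:
  fixes k :: nat and I :: "nat \<Rightarrow> real set" and A :: "real set" and f :: "real \<Rightarrow> real"
  assumes "k \<ge> 1"
    and "\<And>i. i \<in> {1..k} \<Longrightarrow> is_interval (I i)"
    and "\<And>i. i \<in> {1..k} \<Longrightarrow> I i \<noteq> {}"
    and "\<And>i j. i \<in> {1..k} \<Longrightarrow> j \<in> {1..k} \<Longrightarrow> i \<noteq> j \<Longrightarrow> I i \<inter> I j = {}"
    and "A = (\<Union>i\<in>{1..k}. I i)"
  shows "uniformly_symmetrically_continuous_on A f \<longleftrightarrow> uniformly_continuous_on A f"
proof
  assume sym: "uniformly_symmetrically_continuous_on A f"
  obtain \<delta> where "\<delta> > 0"
    "\<And>x y u v. \<lbrakk>x \<in> A; y \<in> A; \<bar>x - y\<bar> < \<delta>; u \<in> closed_segment x y; v \<in> closed_segment x y;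
      u \<notin> A; v \<notin> A\<rbrakk> \<Longrightarrow> u = v"
    using Union_intervals_segment_misses_at_most_one[of "{1..k}" I A] assms(2,5) by blast
  with sym show "uniformly_continuous_on A f"
    by (rule uniformly_symmetrically_continuous_imp_uniformly_continuous)
qed (rule uniformly_continuous_imp_uniformly_symmetrically_continuous)

end
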